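(* Let $N\ge 2$, $n\ge 1$, $V=\{1,\dots,N\}$ and $\kappa=1$. For every $x=(x_1,\dots,x_N)\in\mathbb{R}^{nN}$, the directed interaction graph $G(x)$ of the topological bounded confidence model with $\kappa=1$ is the union of weakly connected components such that each component contains exactly one circuit (directed cycle), this circuit has length $2$, and the two nodes of the circuit can be reached by directed paths from all nodes of the component.
   Context: For $x=(x_1,\dots,x_N)$ with $x_i\in\mathbb{R}^n$ and $\kappa=1$, the neighbor set $N_i^t(x)$ of agent $i\in V$ consists of the single index $j\in V\setminus\{i\}$ minimizing $\|x_j-x_i\|$ (Euclidean norm), where in case of ties the smallest such index is chosen. The interaction graph $G(x)$ is the directed graph with node set $V$ in which $(i,j)$ is an edge if and only if $j\in N_i^t(x)$; thus every node has exactly one outgoing edge. *)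

theory Defs
  imports "HOL-Analysis.Analysis" "Graph_Theory.Digraph_Component"
begin

(* Agents are the numbers 1..N; the values of x outside {1..N} are never inspected. *)
definition agents :: "nat \<Rightarrow> nat set" where
  "agents N = {1..N}"

(* The neighbor set for kappa = 1: LEAST selects the smallest index among the nearest agents. *)
definition neighbor_set :: "nat \<Rightarrow> (nat \<Rightarrow> real ^ 'n) \<Rightarrow> nat \<Rightarrow> nat set" where
  "neighbor_set N x i =
     {LEAST j. is_arg_min (\<lambda>j. norm (x j - x i)) (\<lambda>j. j \<in> agents N - {i}) j}"

definition interaction_graph :: "nat \<Rightarrow> (nat \<Rightarrow> real ^ 'n) \<Rightarrow> (nat, nat \<times> nat) pre_digraph" where
  "interaction_graph N x =
     with_proj \<lparr> pverts = agents N,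
                 parcs = {(i, j). i \<in> agents N \<and> j \<in> neighbor_set N x i} \<rparr>"

(* Digraph_Component.connected (qualified because of the topological notion of the same name)
   asks for strong connectedness of the symmetrized graph, i.e. weak connectedness. *)
definition weak_components :: "('a, 'b) pre_digraph \<Rightarrow> ('a, 'b) pre_digraph set" where
  "weak_components G = {H. pre_digraph.max_subgraph G Digraph_Component.connected H}"

end

theory Submission
  imports Defs
begin

text \<open>
  Let \<open>f i\<close> be the neighbour of agent \<open>i\<close> and \<open>d i\<close> the distance from \<open>i\<close> to \<open>f i\<close>. Agent \<open>i\<close> is a
  candidate for the neighbour of \<open>f i\<close>, so \<open>d (f i) \<le> d i\<close>; and if equality holds, then \<open>i\<close> is among
  the nearest agents to \<open>f i\<close>, so the tie-breaking rule gives \<open>f (f i) \<le> i\<close>. Therefore \<open>f \<circ> f\<close> either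
  fixes \<open>i\<close> or makes the pair \<open>(d i, i)\<close> lexicographically smaller (lemma \<open>two_steps_descend\<close>).

  Everything else holds for any graph of a map \<open>f\<close> with such a well-founded two-step descent. Iterating
  \<open>f \<circ> f\<close> must stop, so every vertex reaches a fixed point of \<open>f \<circ> f\<close>; and a periodic point cannot
  descend, so it is itself fixed by \<open>f \<circ> f\<close>. As \<open>f\<close> has no fixed points, the cycles are exactly the
  pairs \<open>w, f w\<close> with \<open>f (f w) = w\<close>. Two vertices of a weakly connected graph of a map have a common
  iterate, because this property survives both a forward and a backward step; hence all orbits in a
  component end in the same cycle. A weak component contains with a vertex also the arc leaving it,
  so it is again the graph of \<open>f\<close>, restricted to fewer vertices.
\<close>

section \<open>Weak components\<close>

context wf_digraph
begin

abbreviation weak_class :: "'a \<Rightarrow> 'a set" where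
  "weak_class u \<equiv> {v. u \<rightarrow>\<^sup>*\<^bsub>mk_symmetric G\<^esub> v}"

lemma weak_class_subset: "weak_class u \<subseteq> verts G"
  by (auto elim: reachable_in_vertsE)

lemma weak_class_refl: "u \<in> verts G \<Longrightarrow> u \<in> weak_class u"
  by (simp add: reachable_def)

lemma weak_class_closed:
  assumes "e \<in> arcs G"
  shows "tail G e \<in> weak_class u \<longleftrightarrow> head G e \<in> weak_class u"
proof -
  interpret S: pair_wf_digraph "mk_symmetric G" ..
  have "tail G e \<rightarrow>\<^bsub>mk_symmetric G\<^esub> head G e" "head G e \<rightarrow>\<^bsub>mk_symmetric G\<^esub> tail G e"
    using assms by (auto simp: parcs_mk_symmetric)
  then show ?thesis
    by (auto intro: S.reachable_adj_trans)
qed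

text \<open>
  A walk from \<open>u\<close> in the symmetrized graph stays in the class of \<open>u\<close>, so it survives the restriction.
\<close>

lemma reachable_in_weak_class:
  assumes "u \<rightarrow>\<^sup>*\<^bsub>mk_symmetric G\<^esub> v"
  shows "u \<rightarrow>\<^sup>*\<^bsub>mk_symmetric (G \<restriction> weak_class u)\<^esub> v"
proof -
  interpret S: pair_wf_digraph "mk_symmetric G" ..
  interpret H: wf_digraph "G \<restriction> weak_class u" ..
  interpret T: pair_wf_digraph "mk_symmetric (G \<restriction> weak_class u)" ..
  show ?thesis
    using assms
  proof (induct rule: S.reachable_induct)
    case base
    then show ?case
      using weak_class_refl by (auto intro!: T.reachable_refl)
  next
    case (step y z)
    obtain e where e: "e \<in> arcs G" "{y, z} = {tail G e, head G e}"
        "(y, z) \<in> {(tail G e, head G e), (head G e, tail G e)}"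
      using step(2) by (auto simp: parcs_mk_symmetric)
    have "e \<in> arcs (G \<restriction> weak_class u)"
      using e step(1) weak_class_closed[OF e(1)] by auto
    then have "y \<rightarrow>\<^bsub>mk_symmetric (G \<restriction> weak_class u)\<^esub> z"
      using e by (auto simp: parcs_mk_symmetric simp del: induce_subgraph_arcs)
    with step(3) show ?case
      by (auto intro: T.reachable_adj_trans)
  qed
qed

lemma connected_weak_class:
  assumes "u \<in> verts G"
  shows "Digraph_Component.connected (G \<restriction> weak_class u)"
proof -
  interpret H: wf_digraph "G \<restriction> weak_class u" ..
  interpret T: pair_wf_digraph "mk_symmetric (G \<restriction> weak_class u)" ..
  show ?thesis
  proof (rule H.connectedI)
    show "verts (G \<restriction> weak_class u) \<noteq> {}"
      using weak_class_refl[OF assms] by auto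
  next
    fix v w
    assume "v \<in> verts (G \<restriction> weak_class u)" "w \<in> verts (G \<restriction> weak_class u)"
    then have uv: "u \<rightarrow>\<^sup>*\<^bsub>mk_symmetric (G \<restriction> weak_class u)\<^esub> v"
      and uw: "u \<rightarrow>\<^sup>*\<^bsub>mk_symmetric (G \<restriction> weak_class u)\<^esub> w"
      by (simp_all add: reachable_in_weak_class)
    show "v \<rightarrow>\<^sup>*\<^bsub>mk_symmetric (G \<restriction> weak_class u)\<^esub> w"
      using symmetric_reachable[OF symmetric_mk_symmetric uv] uw by (rule T.reachable_trans)
  qed
qed

lemma connected_subgraph_weak_class:
  assumes "subgraph H G" "Digraph_Component.connected H" "u \<in> verts H"
  shows "subgraph H (G \<restriction> weak_class u)"
proof -
  interpret H: wf_digraph H using assms(1) ..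
  have "u \<rightarrow>\<^sup>*\<^bsub>mk_symmetric G\<^esub> v" if "v \<in> verts H" for v
  proof (rule pre_digraph.reachable_mono)
    show "u \<rightarrow>\<^sup>*\<^bsub>mk_symmetric H\<^esub> v"
      using assms that by (auto simp: Digraph_Component.connected_def)
    show "subgraph (mk_symmetric H) (mk_symmetric G)"
      using assms(1) by (rule subgraph_mk_symmetric)
  qed
  then have V: "verts H \<subseteq> weak_class u"
    by blast
  have ends: "tail G = tail H" "head G = head H"
    using assms(1) by (auto simp: subgraph_def compatible_def)
  show ?thesis
  proof (rule subgraphI)
    show "arcs H \<subseteq> arcs (G \<restriction> weak_class u)"
      using assms(1) V H.wellformed by (auto simp: ends subset_iff elim!: subgraphE)
    show "compatible (G \<restriction> weak_class u) H"
      by (simp add: compatible_def ends)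
  qed (use V in \<open>auto intro: H.wf_digraph\<close>)
qed

text \<open>
  The subgraph induced by a class is connected and contains every connected subgraph that meets the
  class, so the maximal connected subgraphs are exactly these.
\<close>

lemma weak_components_eq: "weak_components G = (\<lambda>u. G \<restriction> weak_class u) ` verts G"
proof (intro equalityI subsetI)
  fix H
  assume "H \<in> weak_components G"
  then have sub: "subgraph H G" and con: "Digraph_Component.connected H"
    and max: "\<And>H'. subgraph H H' \<Longrightarrow> subgraph H' G \<Longrightarrow> Digraph_Component.connected H' \<Longrightarrow> H' = H"
    by (auto simp: weak_components_def max_subgraph_def)
  obtain u where u: "u \<in> verts H"
    using con by (auto simp: Digraph_Component.connected_def strongly_connected_def)
  then have uG: "u \<in> verts G"
    using sub by auto
  have "G \<restriction> weak_class u = H"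
    using connected_subgraph_weak_class[OF sub con u]
      subgraph_induce_subgraphI[OF weak_class_subset] connected_weak_class[OF uG] by (rule max)
  then show "H \<in> (\<lambda>u. G \<restriction> weak_class u) ` verts G"
    using uG by blast
next
  fix H
  assume "H \<in> (\<lambda>u. G \<restriction> weak_class u) ` verts G"
  then obtain u where u: "u \<in> verts G" and H: "H = G \<restriction> weak_class u"
    by blast
  have "H' = H" if "subgraph H H'" "subgraph H' G" "Digraph_Component.connected H'" for H'
  proof -
    have "u \<in> verts H'"
      using subgraph_imp_subverts[OF that(1)] weak_class_refl[OF u] by (auto simp: H)
    then have "subgraph H' H"
      using connected_subgraph_weak_class[OF that(2,3)] by (simp add: H)
    with that(1) show ?thesis
      by (auto simp: subgraph_def compatible_def)
  qed
  then show "H \<in> weak_components G"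
    using subgraph_induce_subgraphI[OF weak_class_subset] connected_weak_class[OF u]
    by (auto simp: weak_components_def max_subgraph_def H)
qed

lemma Union_weak_components: "pre_digraph.Union G (weak_components G) = G"
proof -
  have "(\<Union>H\<in>weak_components G. verts H) = verts G"
    using weak_class_refl weak_class_subset by (auto simp: weak_components_eq)
  moreover have "(\<Union>H\<in>weak_components G. arcs H) = arcs G"
  proof -
    have "e \<in> arcs (G \<restriction> weak_class (tail G e))" if e: "e \<in> arcs G" for e
      using e weak_class_refl[of "tail G e"] weak_class_closed[OF e, of "tail G e"] by simp
    then have "arcs G \<subseteq> (\<Union>H\<in>weak_components G. arcs H)"
      using tail_in_verts by (fastforce simp: weak_components_eq)
    then show ?thesis
      by (auto simp: weak_components_eq)
  qed
  ultimately show ?thesis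
    by (simp add: Union_def)
qed

end

section \<open>Graphs of maps\<close>

locale map_digraph = wf_digraph G for G :: "('a, 'a \<times> 'a) pre_digraph" (structure) +
  fixes f :: "'a \<Rightarrow> 'a"
  assumes arcs_eq: "arcs G = (\<lambda>v. (v, f v)) ` verts G"
    and tail_eq: "tail G = fst"
    and head_eq: "head G = snd"
begin

lemma map_in_verts: "v \<in> verts G \<Longrightarrow> f v \<in> verts G"
  using head_in_verts[of "(v, f v)"] by (simp add: arcs_eq head_eq)

lemma iterate_in_verts: "v \<in> verts G \<Longrightarrow> (f ^^ k) v \<in> verts G"
  by (induction k) (auto intro: map_in_verts)

lemma dominates_iff: "u \<rightarrow> v \<longleftrightarrow> u \<in> verts G \<and> v = f u"
  by (auto simp: arcs_ends_conv arcs_eq tail_eq head_eq)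

lemma reachable_iterate: "v \<in> verts G \<Longrightarrow> v \<rightarrow>\<^sup>* (f ^^ k) v"
proof (induction k)
  case (Suc k)
  then show ?case
    using reachable_adj_trans[of v "(f ^^ k) v" "(f ^^ Suc k) v"] iterate_in_verts
    by (simp add: dominates_iff)
qed auto

lemma awalk_end: "awalk u p v \<Longrightarrow> v = (f ^^ length p) u"
proof (induction p arbitrary: u)
  case (Cons e p)
  then have "head G e = f u" "awalk (head G e) p v"
    by (auto simp: awalk_Cons_iff arcs_eq tail_eq head_eq)
  with Cons.IH show ?case
    by (simp add: funpow_swap1)
qed (simp add: awalk_Nil_iff)

text \<open>
  Having a common iterate is preserved by each step of a walk in the symmetrized graph: the step
  replaces a vertex by its image or by a preimage.
\<close>

lemma connected_common_iterate:
  assumes "Digraph_Component.connected G" "u \<in> verts G" "v \<in> verts G"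
  shows "\<exists>a b. (f ^^ a) u = (f ^^ b) v"
proof -
  interpret S: pair_wf_digraph "mk_symmetric G" ..
  have "u \<rightarrow>\<^sup>*\<^bsub>mk_symmetric G\<^esub> v"
    using assms by (auto simp: Digraph_Component.connected_def)
  then show ?thesis
  proof (induct rule: S.reachable_induct)
    case base
    show ?case by blast
  next
    case (step y z)
    then obtain a b where ab: "(f ^^ a) u = (f ^^ b) y"
      by blast
    from step(2) consider "z = f y" | "y = f z"
      by (auto simp: parcs_mk_symmetric arcs_eq tail_eq head_eq)
    then show ?case
    proof cases
      case 1
      then have "(f ^^ Suc a) u = (f ^^ b) z"
        using ab by (simp add: funpow_swap1)
      then show ?thesis by blast
    next
      case 2
      then have "(f ^^ a) u = (f ^^ Suc b) z"
        using ab by (simp add: funpow_swap1)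
      then show ?thesis by blast
    qed
  qed
qed

lemma map_digraph_weak_component:
  assumes "H \<in> weak_components G"
  shows "map_digraph H f"
proof -
  obtain u where H: "H = G \<restriction> weak_class u"
    using assms by (auto simp: weak_components_eq)
  interpret H: wf_digraph H
    unfolding H ..
  have closed: "f v \<in> weak_class u" if "v \<in> weak_class u" for v
    using weak_class_closed[of "(v, f v)" u] weak_class_subset that
    by (auto simp: arcs_eq tail_eq head_eq)
  show ?thesis
  proof
    show "arcs H = (\<lambda>v. (v, f v)) ` verts H"
      using closed weak_class_subset by (auto simp: H arcs_eq tail_eq head_eq)
  qed (simp_all add: H tail_eq head_eq)
qed

end

section \<open>Maps with a two-step descent\<close>

locale two_step_descent = map_digraph +
  fixes r :: "('a \<times> 'a) set"
  assumes wf_descent: "wf r"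
    and no_fixpoint: "v \<in> verts G \<Longrightarrow> f v \<noteq> v"
    and descent: "v \<in> verts G \<Longrightarrow> f (f v) \<noteq> v \<Longrightarrow> (f (f v), v) \<in> r"
begin

lemma reaches_two_periodic: "v \<in> verts G \<Longrightarrow> \<exists>k. f (f ((f ^^ k) v)) = (f ^^ k) v"
  using wf_descent
proof (induction v rule: wf_induct_rule)
  case (less v)
  show ?case
  proof (cases "f (f v) = v")
    case True
    then have "f (f ((f ^^ 0) v)) = (f ^^ 0) v" by simp
    then show ?thesis by blast
  next
    case False
    with less obtain k where "f (f ((f ^^ k) (f (f v)))) = (f ^^ k) (f (f v))"
      using descent map_in_verts by blast
    then have "f (f ((f ^^ Suc (Suc k)) v)) = (f ^^ Suc (Suc k)) v"
      by (simp add: funpow_swap1)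
    then show ?thesis by blast
  qed
qed

text \<open>
  If \<open>f (f v)\<close> differed from \<open>v\<close>, the orbit of \<open>v\<close> under \<open>f \<circ> f\<close> would start with a strict descent and could never climb
  back to \<open>v\<close>. Running through the period twice makes the number of steps even.
\<close>

lemma periodic_imp_two_periodic:
  assumes v: "v \<in> verts G" and "0 < k" and k: "(f ^^ k) v = v"
  shows "f (f v) = v"
proof (rule ccontr)
  assume neq: "f (f v) \<noteq> v"
  have below: "((f ^^ (2 * Suc j)) v, v) \<in> r\<^sup>+" for j
  proof (induction j)
    case 0
    then show ?case
      using descent[OF v neq] by (simp add: numeral_2_eq_2)
  next
    case (Suc j)
    let ?w = "(f ^^ (2 * Suc j)) v"
    have "(f ^^ (2 * Suc (Suc j))) v = f (f ?w)"
      by simp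
    moreover have "f (f ?w) = ?w \<or> (f (f ?w), ?w) \<in> r"
      using descent iterate_in_verts[OF v] by blast
    ultimately show ?case
      using Suc.IH by (metis trancl_into_trancl2)
  qed
  have "(f ^^ (2 * k)) v = v"
    using k by (simp add: mult_2 funpow_add)
  then have "(v, v) \<in> r\<^sup>+"
    using below[of "k - 1"] \<open>0 < k\<close> by simp
  then show False
    using wf_trancl[OF wf_descent] by (meson wf_irrefl)
qed

lemma cycle_iff:
  "cycle p \<longleftrightarrow> (\<exists>u\<in>verts G. f (f u) = u \<and> p = [(u, f u), (f u, u)])"
proof
  assume "cycle p"
  then obtain u where walk: "awalk u p u" and dist: "distinct p" and ne: "p \<noteq> []"
    by (auto simp: cycle_conv)
  have u: "u \<in> verts G"
    using walk by (rule awalk_hd_in_verts)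
  have two: "f (f u) = u"
    using periodic_imp_two_periodic[OF u _ awalk_end[OF walk, symmetric]] ne by simp
  have "p = [(u, f u), (f u, u)]"
    \<comment> \<open>This rule splits lists into those of length zero, one, and at least two.\<close>
  proof (cases p rule: remdups_adj.cases)
    case 1
    then show ?thesis using ne by simp
  next
    case (2 e)
    then show ?thesis
      using awalk_end[OF walk] no_fixpoint[OF u] by simp
  next
    case (3 e e' es)
    then have e: "e = (u, f u)" "e' = (f u, u)" and rest: "awalk u es u"
      using walk two by (auto simp: awalk_Cons_iff arcs_eq tail_eq head_eq)
    \<comment> \<open>A third arc would leave \<open>u\<close> and so repeat the first one.\<close>
    have "es = []"
      using dist 3 e rest
      by (cases es) (auto simp: awalk_Cons_iff arcs_eq tail_eq head_eq)
    with 3 e show ?thesis by simp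
  qed
  with u two show "\<exists>u\<in>verts G. f (f u) = u \<and> p = [(u, f u), (f u, u)]"
    by blast
next
  assume "\<exists>u\<in>verts G. f (f u) = u \<and> p = [(u, f u), (f u, u)]"
  then obtain u where u: "u \<in> verts G" "f (f u) = u" and p: "p = [(u, f u), (f u, u)]"
    by blast
  have "awalk u p u"
    using u map_in_verts[OF u(1)]
    by (auto simp: p awalk_Cons_iff awalk_Nil_iff arcs_eq tail_eq head_eq image_iff)
  moreover have "distinct (tl (awalk_verts u p))"
    using no_fixpoint[OF u(1)] by (simp add: p tail_eq head_eq)
  ultimately show "cycle p"
    by (auto simp: cycle_def p)
qed

lemma two_periodic_iterate: "f (f w) = w \<Longrightarrow> (f ^^ k) w \<in> {w, f w}"
  by (induction k) auto

text \<open>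
  The orbit of \<open>w\<close> is just \<open>{w, f w}\<close>, so a common iterate of \<open>v\<close> and \<open>w\<close> is \<open>w\<close> or one step before it.
\<close>

lemma connected_two_periodic:
  assumes con: "Digraph_Component.connected G"
    and v: "v \<in> verts G" and w: "w \<in> verts G" "f (f w) = w"
  shows "\<exists>k. (f ^^ k) v = w"
proof -
  obtain a b where ab: "(f ^^ a) v = (f ^^ b) w"
    using connected_common_iterate[OF con v w(1)] by blast
  then consider "(f ^^ a) v = w" | "(f ^^ Suc a) v = w"
    using two_periodic_iterate[OF w(2), of b] w(2) by auto
  then show ?thesis
    by cases blast+
qed

theorem connected_unique_cycle:
  assumes con: "Digraph_Component.connected G"
  shows "\<exists>p. cycle p \<and> (\<forall>q. cycle q \<longrightarrow> (\<exists>k. q = rotate k p)) \<and> length p = 2 \<and>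
    (\<forall>v \<in> verts G. \<forall>w \<in> tail G ` set p. v \<rightarrow>\<^sup>* w)"
proof -
  obtain v where "v \<in> verts G"
    using con by (auto simp: Digraph_Component.connected_def strongly_connected_def)
  then obtain w where w: "w \<in> verts G" "f (f w) = w"
    using reaches_two_periodic iterate_in_verts by blast
  define p where "p = [(w, f w), (f w, w)]"
  have "\<exists>k. q = rotate k p" if "cycle q" for q
  proof -
    obtain u where u: "u \<in> verts G" "f (f u) = u" "q = [(u, f u), (f u, u)]"
      using \<open>cycle q\<close> by (auto simp: cycle_iff)
    then have "u \<in> {w, f w}"
      using connected_two_periodic[OF con w(1) u(1,2)] two_periodic_iterate[OF w(2)] by metis
    then have "q = rotate 0 p \<or> q = rotate 1 p"
      using u w by (auto simp: p_def)
    then show ?thesis by blast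
  qed
  moreover have "v \<rightarrow>\<^sup>* z" if v: "v \<in> verts G" and "z \<in> tail G ` set p" for v z
  proof -
    have "z \<in> verts G" "f (f z) = z"
      using that w map_in_verts by (auto simp: p_def tail_eq)
    then obtain k where "(f ^^ k) v = z"
      using connected_two_periodic[OF con v] by blast
    then show ?thesis
      using reachable_iterate[OF v] by blast
  qed
  moreover have "cycle p"
    using w by (auto simp: cycle_iff p_def)
  ultimately show ?thesis
    by (auto simp: p_def intro!: exI[of _ p])
qed

end

section \<open>Nearest neighbours\<close>

definition nearest :: "nat \<Rightarrow> (nat \<Rightarrow> real ^ 'n) \<Rightarrow> nat \<Rightarrow> nat" where
  "nearest N x i = (LEAST j. is_arg_min (\<lambda>j. norm (x j - x i)) (\<lambda>j. j \<in> agents N - {i}) j)"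

lemma nearest_is_arg_min:
  assumes "N \<ge> 2"
  shows "is_arg_min (\<lambda>j. norm (x j - x i)) (\<lambda>j. j \<in> agents N - {i}) (nearest N x i)"
proof -
  have "(if i = 1 then 2 else 1) \<in> agents N - {i}"
    using assms by (auto simp: agents_def)
  then have "agents N - {i} \<noteq> {}" "finite (agents N - {i})"
    by (auto simp: agents_def)
  then have "\<exists>j. is_arg_min (\<lambda>j. norm (x j - x i)) (\<lambda>j. j \<in> agents N - {i}) j"
    using ex_is_arg_min_if_finite by metis
  then show ?thesis
    unfolding nearest_def by (rule LeastI_ex)
qed

text \<open>
  The restriction to the finite set of agents is what makes this strict lexicographic order
  well-founded, since it compares real distances.
\<close>

definition distance_index_less :: "nat \<Rightarrow> (nat \<Rightarrow> real ^ 'n) \<Rightarrow> (nat \<times> nat) set" where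
  "distance_index_less N x = {(i, j) \<in> agents N \<times> agents N.
     norm (x (nearest N x i) - x i) < norm (x (nearest N x j) - x j) \<or>
     norm (x (nearest N x i) - x i) = norm (x (nearest N x j) - x j) \<and> i < j}"

lemma wf_distance_index_less: "wf (distance_index_less N x)"
proof (rule finite_acyclic_wf)
  show "finite (distance_index_less N x)"
    by (rule finite_subset[of _ "agents N \<times> agents N"])
      (auto simp: distance_index_less_def agents_def)
  have "trans (distance_index_less N x)" "irrefl (distance_index_less N x)"
    by (auto simp: distance_index_less_def trans_def irrefl_def)
  then show "acyclic (distance_index_less N x)"
    by (simp add: acyclic_irrefl trancl_id)
qed

lemma two_steps_descend:
  fixes x :: "nat \<Rightarrow> real ^ 'n"
  assumes N: "N \<ge> 2" and i: "i \<in> agents N"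
    and neq: "nearest N x (nearest N x i) \<noteq> i"
  shows "(nearest N x (nearest N x i), i) \<in> distance_index_less N x"
proof -
  define j where "j = nearest N x i"
  define k where "k = nearest N x j"
  define d where "d l = norm (x (nearest N x l) - x l)" for l
  have mem: "nearest N x l \<in> agents N" "nearest N x l \<noteq> l" for l
    using nearest_is_arg_min[OF N, of x l] by (auto simp: is_arg_min_def)
  have least: "d l \<le> norm (x m - x l)" if "m \<in> agents N" "m \<noteq> l" for l m
    using nearest_is_arg_min[OF N, of x l] that by (auto simp: is_arg_min_def d_def not_less)
  have ji: "j \<noteq> i" and kj: "k \<noteq> j" and jN: "j \<in> agents N" and kN: "k \<in> agents N"
    using mem by (auto simp: j_def k_def)
  have di: "norm (x i - x j) = d i" and dj: "norm (x j - x k) = d j"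
    by (simp_all add: d_def j_def k_def norm_minus_commute)
  have "d j \<le> d i" "d k \<le> d j"
    using least[of i j] least[of j k] i ji kj jN di dj by auto
  moreover have "k \<le> i" if "d j = d i"
  proof -
    have "is_arg_min (\<lambda>m. norm (x m - x j)) (\<lambda>m. m \<in> agents N - {j}) i"
      using least[of _ j] i ji that di by (force simp: is_arg_min_def not_less)
    then show ?thesis
      unfolding k_def nearest_def by (rule Least_le)
  qed
  ultimately have "d k < d i \<or> d k = d i \<and> k < i"
    using neq by (fastforce simp: k_def j_def)
  then show ?thesis
    using i kN by (simp add: distance_index_less_def k_def j_def d_def)
qed

lemma map_digraph_interaction_graph:
  assumes "N \<ge> 2"
  shows "map_digraph (interaction_graph N x) (nearest N x)"
proof
  have mem: "nearest N x i \<in> agents N" for i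
    using nearest_is_arg_min[OF assms, of x i] by (auto simp: is_arg_min_def)
  fix e
  assume "e \<in> arcs (interaction_graph N x)"
  then show "tail (interaction_graph N x) e \<in> verts (interaction_graph N x)"
    and "head (interaction_graph N x) e \<in> verts (interaction_graph N x)"
    using mem
    by (auto simp: interaction_graph_def neighbor_set_def nearest_def)
next
  show "arcs (interaction_graph N x) =
      (\<lambda>i. (i, nearest N x i)) ` verts (interaction_graph N x)"
    by (auto simp: interaction_graph_def neighbor_set_def nearest_def)
qed (simp_all add: interaction_graph_def)

theorem proposition12:
  fixes N :: nat and x :: "nat \<Rightarrow> real ^ 'n"
  defines "G \<equiv> interaction_graph N x"
  assumes "N \<ge> 2"
  shows "G = pre_digraph.Union G (weak_components G) \<and>
    (\<forall>H \<in> weak_components G.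
      \<exists>p. pre_digraph.cycle H p \<and>
          (\<forall>q. pre_digraph.cycle H q \<longrightarrow> (\<exists>k. q = rotate k p)) \<and>
          length p = 2 \<and>
          (\<forall>v \<in> verts H. \<forall>w \<in> tail H ` set p. v \<rightarrow>\<^sup>*\<^bsub>H\<^esub> w))"
proof (intro conjI ballI)
  interpret G: map_digraph G "nearest N x"
    unfolding G_def using \<open>N \<ge> 2\<close> by (rule map_digraph_interaction_graph)
  show "G = pre_digraph.Union G (weak_components G)"
    by (rule G.Union_weak_components[symmetric])
  fix H
  assume H: "H \<in> weak_components G"
  then have sub: "subgraph H G" and con: "Digraph_Component.connected H"
    by (auto simp: weak_components_def G.max_subgraph_def)
  have agents: "verts H \<subseteq> agents N"
    using sub by (auto simp: G_def interaction_graph_def elim!: subgraphE)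
  interpret H: map_digraph H "nearest N x"
    using H by (rule G.map_digraph_weak_component)
  interpret H: two_step_descent H "nearest N x" "distance_index_less N x"
  proof
    show "wf (distance_index_less N x)"
      by (rule wf_distance_index_less)
  next
    fix v
    assume v: "v \<in> verts H"
    show "nearest N x v \<noteq> v"
      using nearest_is_arg_min[OF \<open>N \<ge> 2\<close>, of x v] by (auto simp: is_arg_min_def)
    assume "nearest N x (nearest N x v) \<noteq> v"
    then show "(nearest N x (nearest N x v), v) \<in> distance_index_less N x"
      using two_steps_descend[OF \<open>N \<ge> 2\<close>] v agents by blast
  qed
  show "\<exists>p. pre_digraph.cycle H p \<and>
          (\<forall>q. pre_digraph.cycle H q \<longrightarrow> (\<exists>k. q = rotate k p)) \<and>
          length p = 2 \<and>
          (\<forall>v \<in> verts H. \<forall>w \<in> tail H ` set p. v \<rightarrow>\<^sup>*\<^bsub>H\<^esub> w)"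
    using con by (rule H.connected_unique_cycle)
qed

end
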